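(* Let $a,b,c,d,p,q,r>0$ be real constants and let $m\in(0,1]$. Consider the Caputo fractional order system $$^{c}_{0}D^{m}_{t}x = x(1-x)-\frac{xy}{x+a},\qquad {}^{c}_{0}D^{m}_{t}y=\frac{cxy}{x+a}-by-\frac{yz}{y+d},\qquad {}^{c}_{0}D^{m}_{t}z=pz^2-\frac{qz^2}{y+r}.$$ Suppose that the interior equilibrium $E^*=(x^*,y^*,z^* )$, given by $$y^*=\frac{q}{p}-r,\qquad x^*=\frac{1-a}{2}+\sqrt{\Big(\frac{1+a}{2}\Big)^2-y^*},\qquad z^*=\Big(-b+\frac{cx^*}{a+x^*}\Big)(y^*+d),$$ exists, i.e. $y^*\le\left(\frac{1+a}{2}\right)^2$ and $x^*,y^*,z^*>0$. Set $$A_1=\frac{x^*}{a+x^*}(2x^*+a-1)-\frac{y^*z^*}{(y^*+d)^2},$$ $$A_2=\frac{p\,y^*(z^* )^2}{(y^*+r)(y^*+d)}+\frac{x^*y^*z^*}{(a+x^* )(y^*+d)^2}(1-a-2x^* )+\frac{acx^*(1-x^* )}{(a+x^* )^2},$$ $$A_3=\frac{x^*}{a+x^*}(2x^*+a-1)\,\frac{p\,y^*(z^* )^2}{(y^*+r)(y^*+d)},$$ which are the coefficients of the characteristic polynomial $F(\xi)=\xi^3+A_1\xi^2+A_2\xi+A_3$ of the Jacobian matrix of the system at $E^*$, and let $$D(F)=18A_1A_2A_3+(A_1A_2)^2-4A_3A_1^3-4A_2^3-27A_3^2$$ be the discriminant of $F$. Then: (i) If $D(F)>0$, $A_1>0$,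 $A_3>0$ and $A_1A_2-A_3>0$, then $E^*$ is locally asymptotically stable for all $m\in(0,1]$. (ii) If $D(F)<0$, $A_1\ge 0$, $A_2\ge 0$, $A_3>0$ and $0<m<\frac23$, then $E^*$ is locally asymptotically stable. (iii) If $D(F)<0$, $A_1<0$, $A_2<0$ and $m>\frac23$, then $E^*$ is unstable. (iv) If $D(F)<0$, $A_1>0$, $A_2>0$, $A_1A_2=A_3$ and $0<m<1$, then $E^*$ is locally asymptotically stable.
   Context: For $0<m<1$ the Caputo derivative of order $m$ is ${}^{c}_{0}D^{m}_{t}u(t)=\frac{1}{\Gamma(1-m)}\int_0^t (t-s)^{-m}u'(s)\,ds$; for $m=1$ it is the ordinary derivative. The Jacobian matrix at $E^*$ is $$J(E^* )=\begin{pmatrix}\frac{x^*}{a+x^*}(1-a-2x^* ) & \frac{-x^*}{a+x^*} & 0\\ \frac{ac(1-x^* )}{a+x^*} & \frac{y^*z^*}{(y^*+d)^2} & \frac{-y^*}{y^*+d}\\ 0 & \frac{p(z^* )^2}{y^*+r} & 0\end{pmatrix}.$$ Stability is understood in the spectral sense for fractional order systems: with principal argument $\arg\in(-\pi,\pi]$, the equilibrium $E^*$ of the order-$m$ system is called locally asymptotically stable if all three roots $\xi_1,\xi_2,\xi_3$ of $F(\xi)=0$ (the eigenvalues of $J(E^* )$) are nonzero and satisfy $|\arg(\xi_i)|>\frac{m\pi}{2}$; it is called unstable if some nonzero eigenvalue satisfies $|\arg(\xi_i)|<\frac{m\pi}{2}$. *)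

theory Defs
  imports "HOL-Analysis.Analysis" "HOL-Computational_Algebra.Polynomial"
begin

(* Relational form, so that existence of the derivative (and of the singular integral) is part
   of the notion.  The set integral is a Lebesgue integral because of absolute integrability.
   Only orders 0 < m <= 1 are meaningful. *)
definition has_caputo_derivative ::
    "real \<Rightarrow> (real \<Rightarrow> real) \<Rightarrow> real \<Rightarrow> real \<Rightarrow> bool" where
  "has_caputo_derivative m u l t \<longleftrightarrow>
     (if m = 1 then (u has_real_derivative l) (at t)
      else (\<exists>u'. (\<forall>s\<in>{0<..<t}. (u has_real_derivative u' s) (at s)) \<and>
                 (\<lambda>s. (t - s) powr (- m) * u' s) absolutely_integrable_on {0<..<t} \<and>
                 l = 1 / Gamma (1 - m) * integral {0<..<t} (\<lambda>s. (t - s) powr (- m) * u' s)))"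

definition caputo_solution :: "real \<Rightarrow> (real^'n \<Rightarrow> real^'n) \<Rightarrow> (real \<Rightarrow> real^'n) \<Rightarrow> bool" where
  "caputo_solution m f u \<longleftrightarrow> continuous_on {0..} u \<and>
     (\<forall>t>0. \<forall>i. has_caputo_derivative m (\<lambda>s. u s $ i) (f (u t) $ i) t)"

definition caputo_equilibrium :: "real \<Rightarrow> (real^'n \<Rightarrow> real^'n) \<Rightarrow> real^'n \<Rightarrow> bool" where
  "caputo_equilibrium m f E \<longleftrightarrow> caputo_solution m f (\<lambda>_. E)"

definition charpoly :: "real^'n^'n \<Rightarrow> real poly" where
  "charpoly A = det (mat [:0, 1:] - map_matrix (\<lambda>x. [:x:]) A)"

definition eigenvalues :: "real^'n^'n \<Rightarrow> complex set" where
  "eigenvalues A = {\<xi>. poly (map_poly complex_of_real (charpoly A)) \<xi> = 0}"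

(* Stability in the spectral sense for order m; Arg takes values in (-pi, pi]. *)
definition locally_asymptotically_stable ::
    "real \<Rightarrow> (real^'n \<Rightarrow> real^'n) \<Rightarrow> real^'n \<Rightarrow> bool" where
  "locally_asymptotically_stable m f E \<longleftrightarrow>
     (\<forall>\<xi>\<in>eigenvalues (jacobian f (at E)). \<xi> \<noteq> 0 \<and> \<bar>Arg \<xi>\<bar> > m * pi / 2)"

definition unstable :: "real \<Rightarrow> (real^'n \<Rightarrow> real^'n) \<Rightarrow> real^'n \<Rightarrow> bool" where
  "unstable m f E \<longleftrightarrow>
     (\<exists>\<xi>\<in>eigenvalues (jacobian f (at E)). \<xi> \<noteq> 0 \<and> \<bar>Arg \<xi>\<bar> < m * pi / 2)"

definition food_chain_field ::
    "real \<Rightarrow> real \<Rightarrow> real \<Rightarrow> real \<Rightarrow> real \<Rightarrow> real \<Rightarrow> real \<Rightarrow> real^3 \<Rightarrow> real^3" where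
  "food_chain_field a b c d p q r v =
     (let x = v $ 1; y = v $ 2; z = v $ 3 in
      vector [x * (1 - x) - x * y / (x + a),
              c * x * y / (x + a) - b * y - y * z / (y + d),
              p * z^2 - q * z^2 / (y + r)])"

end

theory Submission
  imports Defs "HOL-Computational_Algebra.Fundamental_Theorem_Algebra"
begin

text \<open>
  Comparing \<open>\<bar>Arg \<xi>\<bar>\<close> with an angle amounts to comparing \<open>Re \<xi>\<close> with a multiple of \<open>cmod \<xi>\<close>.
  For a non-real root \<open>u + \<i> v\<close> of a real cubic, the imaginary part of the equation gives
  \<open>v\<^sup>2 = 3 u\<^sup>2 + 2 A1 u + A2\<close>.  Hence for \<open>u > 0\<close> the signs of \<open>A1\<close> and \<open>A2\<close> decide on which
  side of the rays of argument \<open>\<plusminus>\<pi>/3\<close> the root lies, and eliminating \<open>v\<close> from the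
  real part yields the Routh-Hurwitz criterion.  If \<open>A1 < 0\<close>, then the roots have positive sum,
  so one of them has positive real part.
\<close>

section \<open>Arguments compared through real parts\<close>

lemma cos_abs_Arg:
  assumes "z \<noteq> 0"
  shows "cmod z * cos \<bar>Arg z\<bar> = Re z"
  using assms by (simp add: cos_Arg abs_if)

text \<open>The cosine is strictly decreasing on [0, pi], which contains both angles, and
  \<open>cmod z\<close> is positive, so \<open>Arg\<close> can be eliminated.\<close>

lemma less_abs_Arg_iff:
  assumes "z \<noteq> 0" "0 \<le> t" "t \<le> pi"
  shows "t < \<bar>Arg z\<bar> \<longleftrightarrow> Re z < cmod z * cos t"
proof -
  have "\<bar>Arg z\<bar> \<le> pi" using mpi_less_Arg[of z] Arg_le_pi[of z] by linarith
  then have "t < \<bar>Arg z\<bar> \<longleftrightarrow> cos \<bar>Arg z\<bar> < cos t"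
    using assms by (intro cos_mono_less_eq[symmetric]) auto
  also have "\<dots> \<longleftrightarrow> cmod z * cos \<bar>Arg z\<bar> < cmod z * cos t"
    using assms by simp
  finally show ?thesis using cos_abs_Arg[OF assms(1)] by simp
qed

lemma abs_Arg_less_iff:
  assumes "z \<noteq> 0" "0 \<le> t" "t \<le> pi"
  shows "\<bar>Arg z\<bar> < t \<longleftrightarrow> cmod z * cos t < Re z"
proof -
  have "\<bar>Arg z\<bar> \<le> pi" using mpi_less_Arg[of z] Arg_le_pi[of z] by linarith
  then have "\<bar>Arg z\<bar> < t \<longleftrightarrow> cos t < cos \<bar>Arg z\<bar>"
    using assms by (intro cos_mono_less_eq[symmetric]) auto
  also have "\<dots> \<longleftrightarrow> cmod z * cos t < cmod z * cos \<bar>Arg z\<bar>"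
    using assms by simp
  finally show ?thesis using cos_abs_Arg[OF assms(1)] by simp
qed

lemma pi_half_less_abs_Arg:
  assumes "Re z < 0"
  shows "pi / 2 < \<bar>Arg z\<bar>"
proof -
  have "z \<noteq> 0" using assms by auto
  then show ?thesis using assms less_abs_Arg_iff[of z "pi/2"] by simp
qed

lemma pi_half_le_abs_Arg:
  assumes "z \<noteq> 0" "Re z \<le> 0"
  shows "pi / 2 \<le> \<bar>Arg z\<bar>"
  using assms abs_Arg_less_iff[of z "pi/2"] by simp

section \<open>Location of the roots of a real cubic\<close>

lemma cubic_root_Re_Im:
  fixes A1 A2 A3 :: real
  assumes "poly (map_poly complex_of_real [:A3, A2, A1, 1:]) z = 0"
  shows "Re z ^ 3 - 3 * Re z * (Im z)\<^sup>2 + A1 * ((Re z)\<^sup>2 - (Im z)\<^sup>2) + A2 * Re z + A3 = 0"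
    and "Im z = 0 \<or> (Im z)\<^sup>2 = 3 * (Re z)\<^sup>2 + 2 * A1 * Re z + A2"
proof -
  have z: "z * (z * (z + A1) + A2) + A3 = 0"
    using assms by (simp add: map_poly_pCons algebra_simps)
  have "Re (z * (z * (z + A1) + A2) + A3) = 0" unfolding z by simp
  then show "Re z ^ 3 - 3 * Re z * (Im z)\<^sup>2 + A1 * ((Re z)\<^sup>2 - (Im z)\<^sup>2) + A2 * Re z + A3 = 0"
    by (simp add: algebra_simps power2_eq_square power3_eq_cube)
  have "Im (z * (z * (z + A1) + A2) + A3) = 0" unfolding z by simp
  then have "Im z * (3 * (Re z)\<^sup>2 + 2 * A1 * Re z + A2 - (Im z)\<^sup>2) = 0"
    by (simp add: algebra_simps power2_eq_square)
  then show "Im z = 0 \<or> (Im z)\<^sup>2 = 3 * (Re z)\<^sup>2 + 2 * A1 * Re z + A2" by auto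
qed

lemma real_cubic_root_neg:
  fixes A1 A2 A3 u :: real
  assumes "A1 \<ge> 0" "A2 \<ge> 0" "A3 > 0" "u ^ 3 + A1 * u\<^sup>2 + A2 * u + A3 = 0"
  shows "u < 0"
proof (rule ccontr)
  assume "\<not> u < 0"
  then have "0 \<le> u ^ 3" "0 \<le> A1 * u\<^sup>2" "0 \<le> A2 * u" using assms by auto
  then show False using assms by linarith
qed

text \<open>If z is not real, the third root is -A1 - 2 Re z, so Re z is a real root of -F(-A1 -
  2u), where F is the given cubic. This polynomial in u has positive coefficients, its constant term
  being the Hurwitz determinant A1 A2 - A3, so \<open>real_cubic_root_neg\<close> covers both the
  real and the non-real roots.\<close>

lemma cubic_Routh_Hurwitz:
  fixes A1 A2 A3 :: real
  assumes "A1 > 0" "A3 > 0" "A1 * A2 - A3 > 0"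
    and root: "poly (map_poly complex_of_real [:A3, A2, A1, 1:]) z = 0"
  shows "Re z < 0"
proof -
  have "0 < A1 * A2" using assms by linarith
  then have A2: "A2 > 0" using assms by (simp add: zero_less_mult_iff)
  show ?thesis
  proof (cases "Im z = 0")
    case True
    then show ?thesis
      using cubic_root_Re_Im(1)[OF root] assms A2 by (intro real_cubic_root_neg[of A1 A2 A3]) auto
  next
    case False
    then have v: "(Im z)\<^sup>2 = 3 * (Re z)\<^sup>2 + 2 * A1 * Re z + A2"
      using cubic_root_Re_Im(2)[OF root] by simp
    have eq: "8 * Re z ^ 3 + 8 * A1 * (Re z)\<^sup>2 + 2 * (A2 + A1\<^sup>2) * Re z + (A1 * A2 - A3) = 0"
      using cubic_root_Re_Im(1)[OF root] unfolding v
      by (simp add: algebra_simps power2_eq_square power3_eq_cube)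
    show ?thesis
      \<comment> \<open>These are the coefficients of \<open>eq\<close> after division by 8.\<close>
      by (rule real_cubic_root_neg[of "A1" "(A2 + A1\<^sup>2) / 4" "(A1 * A2 - A3) / 8"])
        (use eq assms A2 in \<open>auto simp: field_simps\<close>)
  qed
qed

text \<open>Since cos (pi/3) = 1/2, the claim is 2 Re z <= |z|. Equality can occur: for A1 = A2 = 0
  the non-real roots of z^3 = -A3 have arguments exactly pi/3 and -pi/3.\<close>

lemma cubic_root_pi_third_le_abs_Arg:
  fixes A1 A2 A3 :: real
  assumes "A1 \<ge> 0" "A2 \<ge> 0" "A3 > 0"
    and root: "poly (map_poly complex_of_real [:A3, A2, A1, 1:]) z = 0"
  shows "pi / 3 \<le> \<bar>Arg z\<bar>"
proof (cases "Re z \<le> 0")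
  case True
  have "z \<noteq> 0" using root assms by (auto simp: map_poly_pCons)
  from pi_half_le_abs_Arg[OF this True] show ?thesis using pi_gt_zero by linarith
next
  case False
  then have z: "z \<noteq> 0" by auto
  \<comment> \<open>A real root would be negative, against Re z > 0.\<close>
  have "Im z \<noteq> 0"
    using False cubic_root_Re_Im(1)[OF root] real_cubic_root_neg[of A1 A2 A3 "Re z"] assms by auto
  then have "(Im z)\<^sup>2 = 3 * (Re z)\<^sup>2 + 2 * A1 * Re z + A2"
    using cubic_root_Re_Im(2)[OF root] by simp
  moreover have "0 \<le> A1 * Re z" using False assms by simp
  ultimately have "(2 * Re z)\<^sup>2 \<le> (cmod z)\<^sup>2"
    using assms by (simp add: cmod_power2)
  then have "2 * Re z \<le> cmod z" by (rule power2_le_imp_le) simp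
  then show ?thesis using abs_Arg_less_iff[OF z, of "pi/3"] by (simp add: cos_60)
qed

text \<open>Take any root t. If Re t <= 0, the two roots of the quadratic cofactor have sum -(A1 +
  t), whose real part is positive, so the one with the larger real part works.\<close>

lemma cubic_has_root_Re_pos:
  fixes A1 A2 A3 :: real
  assumes "A1 < 0"
  obtains z where "poly (map_poly complex_of_real [:A3, A2, A1, 1:]) z = 0" "Re z > 0"
proof -
  let ?P = "map_poly complex_of_real [:A3, A2, A1, 1:]"
  have P: "poly ?P z = z^3 + A1 * z\<^sup>2 + A2 * z + A3" for z :: complex
    by (simp add: map_poly_pCons algebra_simps power2_eq_square power3_eq_cube)
  have "\<not> constant (poly ?P)"
    by (simp add: constant_degree map_poly_pCons)
  then obtain t where t: "poly ?P t = 0"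
    using fundamental_theorem_of_algebra by blast
  show thesis
  proof (cases "Re t > 0")
    case True
    then show thesis using t that by blast
  next
    case False
    \<comment> \<open>Discriminant of the cofactor w^2 + (A1 + t) w + (t^2 + A1 t + A2) left after
      dividing the cubic by w - t.\<close>
    define D where "D = (A1 + t)\<^sup>2 - 4 * (t\<^sup>2 + A1 * t + A2)"
    \<comment> \<open>As \<open>csqrt\<close> has nonnegative real part, the plus sign selects the
      root with the larger real part.\<close>
    define w where "w = (csqrt D - (A1 + t)) / 2"
    have w: "w\<^sup>2 + (A1 + t) * w + (t\<^sup>2 + A1 * t + A2) = 0"
    proof -
      have "2 * w + (A1 + t) = csqrt D" by (simp add: w_def field_simps)
      then have "(2 * w + (A1 + t))\<^sup>2 = D" by simp
      then have "4 * (w\<^sup>2 + (A1 + t) * w + (t\<^sup>2 + A1 * t + A2)) = 0"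
        unfolding D_def by (simp add: algebra_simps power2_eq_square)
      then show ?thesis by (metis mult_eq_0_iff zero_neq_numeral)
    qed
    have "poly ?P w = poly ?P t + (w - t) * (w\<^sup>2 + (A1 + t) * w + (t\<^sup>2 + A1 * t + A2))"
      unfolding P by (simp add: algebra_simps power2_eq_square power3_eq_cube)
    then have "poly ?P w = 0" using t w by simp
    moreover have "Re w > 0"
      using assms False Re_csqrt[of D] by (simp add: w_def del: Re_csqrt csqrt.sel)
    ultimately show thesis using that by blast
  qed
qed

lemma cubic_has_root_abs_Arg_less_pi_third:
  fixes A1 A2 A3 :: real
  assumes "A1 < 0" "A2 < 0"
  obtains z where "poly (map_poly complex_of_real [:A3, A2, A1, 1:]) z = 0"
    "z \<noteq> 0" "\<bar>Arg z\<bar> < pi / 3"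
proof -
  obtain z where root: "poly (map_poly complex_of_real [:A3, A2, A1, 1:]) z = 0"
    and Re: "Re z > 0"
    using cubic_has_root_Re_pos[OF assms(1)] by blast
  then have z: "z \<noteq> 0" by auto
  have "A1 * Re z < 0" using Re assms by (simp add: mult_neg_pos)
  \<comment> \<open>This settles a real z, where |z|^2 = (Re z)^2. For non-real z, |z|^2 = 4 (Re
    z)^2 + 2 A1 Re z + A2, and the last two terms are negative.\<close>
  moreover have "0 < (Re z)\<^sup>2" using Re by simp
  ultimately have "(cmod z)\<^sup>2 < (2 * Re z)\<^sup>2"
    using cubic_root_Re_Im(2)[OF root] assms by (auto simp: cmod_power2)
  then have "cmod z < 2 * Re z" by (rule power2_less_imp_less) (use Re in simp)
  then have "\<bar>Arg z\<bar> < pi / 3" using abs_Arg_less_iff[OF z, of "pi/3"] by (simp add: cos_60)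
  with root z show thesis using that by blast
qed

text \<open>On the Hurwitz boundary the cubic factors as (z + A1)(z^2 + A2). The bound is not strict
  because the second factor has purely imaginary roots.\<close>

lemma cubic_critical_root_Re_nonpos:
  fixes A1 A2 A3 :: real
  assumes "A1 > 0" "A2 > 0" "A1 * A2 = A3"
    and root: "poly (map_poly complex_of_real [:A3, A2, A1, 1:]) z = 0"
  shows "Re z \<le> 0"
proof -
  have "(z + A1) * (z\<^sup>2 + A2) = 0"
    using root by (simp add: map_poly_pCons algebra_simps power2_eq_square flip: assms(3))
  then consider "z = - A1" | "z\<^sup>2 = - of_real A2"
    by (auto simp: add_eq_0_iff2)
  then show ?thesis
  proof cases
    case 1
    then show ?thesis using assms by simp
  next
    case 2
    then have "Re (z\<^sup>2) = - A2" "Im (z\<^sup>2) = 0" by simp_all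
    then have "Re z * Re z - Im z * Im z = - A2" and "Re z = 0 \<or> Im z = 0"
      by (auto simp: power2_eq_square)
    moreover have "Re z * Re z \<noteq> - A2"
      using zero_le_square[of "Re z"] assms(2) by linarith
    ultimately show ?thesis by auto
  qed
qed

section \<open>Characteristic polynomial, equilibria and derivative of the vector field\<close>

lemma charpoly_3:
  fixes A :: "real^3^3"
  shows "charpoly A =
    [: - det A,
       A$1$1 * A$2$2 - A$1$2 * A$2$1 + A$1$1 * A$3$3 - A$1$3 * A$3$1 + A$2$2 * A$3$3 - A$2$3 * A$3$2,
       - (A$1$1 + A$2$2 + A$3$3), 1:]"
  by (simp add: charpoly_def det_3 mat_def map_matrix_def algebra_simps)

lemma caputo_equilibrium_zero:
  assumes "f E = 0"
  shows "caputo_equilibrium m f E"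
proof -
  have "has_caputo_derivative m (\<lambda>s. E $ i) 0 t" for i t
    unfolding has_caputo_derivative_def
    by (auto intro!: exI[of _ "\<lambda>_. 0"] derivative_eq_intros)
  then show ?thesis
    using assms by (simp add: caputo_equilibrium_def caputo_solution_def)
qed

text \<open>The derivative at a general point off the poles; the equilibrium relations turn its
  matrix into \<open>J\<close> later.\<close>

lemma food_chain_field_has_derivative:
  fixes v :: "real^3"
  assumes "v$1 + a \<noteq> 0" "v$2 + d \<noteq> 0" "v$2 + r \<noteq> 0"
  defines "x \<equiv> v$1" and "y \<equiv> v$2" and "z \<equiv> v$3"
  shows "(food_chain_field a b c d p q r has_derivative (\<lambda>h. (vector
       [vector [1 - 2 * x - a * y / (x + a)^2, - x / (x + a), 0],
        vector [a * c * y / (x + a)^2, c * x / (x + a) - b - d * z / (y + d)^2, - y / (y + d)],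
        vector [0, q * z^2 / (y + r)^2, 2 * p * z - 2 * q * z / (y + r)]] :: real^3^3) *v h)) (at v)"
proof -
  \<comment> \<open>The denominators become atoms, so that \<open>field_simps\<close> can clear
    them. The second coordinate gets two descriptions: \<open>Y\<close> for y + d in the first two
    components, \<open>Y'\<close> for y + r in the third.\<close>
  obtain X Y Y' where v: "v$1 = X - a" "v$2 = Y - d" and Y': "v$2 = Y' - r"
    and nz: "X \<noteq> 0" "Y \<noteq> 0" "Y' \<noteq> 0"
    using assms(1-3) by (metis add_diff_cancel_right')
  have 1: "((\<lambda>v. v$1 * (1 - v$1) - v$1 * v$2 / (v$1 + a)) has_derivative
      (\<lambda>h. (1 - 2 * x - a * y / (x + a)^2) * h$1 - x / (x + a) * h$2)) (at v)"
    apply (rule has_derivative_eq_rhs)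
    apply (rule derivative_intros bounded_linear_imp_has_derivative
        bounded_linear_vec_nth assms)+
    apply (use nz in \<open>auto simp: v x_def y_def z_def fun_eq_iff field_simps power2_eq_square\<close>)
    done
  have 2: "((\<lambda>v. c * v$1 * v$2 / (v$1 + a) - b * v$2 - v$2 * v$3 / (v$2 + d)) has_derivative
      (\<lambda>h. a * c * y / (x + a)^2 * h$1 + (c * x / (x + a) - b - d * z / (y + d)^2) * h$2
        - y / (y + d) * h$3)) (at v)"
    apply (rule has_derivative_eq_rhs)
    apply (rule derivative_intros bounded_linear_imp_has_derivative
        bounded_linear_vec_nth assms)+
    apply (use nz in \<open>auto simp: v x_def y_def z_def fun_eq_iff field_simps power2_eq_square\<close>)
    done
  have 3: "((\<lambda>v. p * (v$3)^2 - q * (v$3)^2 / (v$2 + r)) has_derivative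
      (\<lambda>h. q * z^2 / (y + r)^2 * h$2 + (2 * p * z - 2 * q * z / (y + r)) * h$3)) (at v)"
    apply (rule has_derivative_eq_rhs)
    apply (rule derivative_intros bounded_linear_imp_has_derivative
        bounded_linear_vec_nth assms)+
    apply (use nz in \<open>auto simp: v(1) Y' x_def y_def z_def fun_eq_iff field_simps power2_eq_square\<close>)
    done
  show ?thesis
  proof (subst has_derivative_componentwise_within, rule ballI)
    fix i :: "real^3"
    assume "i \<in> Basis"
    then obtain k where k: "i = axis k 1" by (auto simp: Basis_vec_def)
    show "((\<lambda>v. food_chain_field a b c d p q r v \<bullet> i) has_derivative (\<lambda>h. ((vector
       [vector [1 - 2 * x - a * y / (x + a)^2, - x / (x + a), 0],
        vector [a * c * y / (x + a)^2, c * x / (x + a) - b - d * z / (y + d)^2, - y / (y + d)],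
        vector [0, q * z^2 / (y + r)^2, 2 * p * z - 2 * q * z / (y + r)]] :: real^3^3) *v h) \<bullet> i)) (at v)"
      unfolding k inner_axis using exhaust_3[of k] 1 2 3
      by (elim disjE) (simp_all add: food_chain_field_def Let_def matrix_vector_mult_def sum_3)
  qed
qed

section \<open>The interior equilibrium and its spectral stability\<close>

theorem theorem2:
  fixes a b c d p q r m xs ys zs A1 A2 A3 DF :: real
    and E :: "real^3" and f :: "real^3 \<Rightarrow> real^3" and J :: "real^3^3"
  assumes pos: "a > 0" "b > 0" "c > 0" "d > 0" "p > 0" "q > 0" "r > 0"
    and m: "0 < m" "m \<le> 1"
    and f: "f = food_chain_field a b c d p q r"
    and ys: "ys = q / p - r"
    and xs: "xs = (1 - a) / 2 + sqrt (((1 + a) / 2)^2 - ys)"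
    and zs: "zs = (- b + c * xs / (a + xs)) * (ys + d)"
    and ex: "ys \<le> ((1 + a) / 2)^2" "xs > 0" "ys > 0" "zs > 0"
    and E: "E = vector [xs, ys, zs]"
    and J: "J = vector
       [vector [xs / (a + xs) * (1 - a - 2 * xs), - xs / (a + xs), 0],
        vector [a * c * (1 - xs) / (a + xs), ys * zs / (ys + d)^2, - ys / (ys + d)],
        vector [0, p * zs^2 / (ys + r), 0]]"
    and A1: "A1 = xs / (a + xs) * (2 * xs + a - 1) - ys * zs / (ys + d)^2"
    and A2: "A2 = p * ys * zs^2 / ((ys + r) * (ys + d))
                  + xs * ys * zs / ((a + xs) * (ys + d)^2) * (1 - a - 2 * xs)
                  + a * c * xs * (1 - xs) / (a + xs)^2"
    and A3: "A3 = xs / (a + xs) * (2 * xs + a - 1) * (p * ys * zs^2 / ((ys + r) * (ys + d)))"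
    and DF: "DF = 18 * A1 * A2 * A3 + (A1 * A2)^2 - 4 * A3 * A1^3 - 4 * A2^3 - 27 * A3^2"
  shows "caputo_equilibrium m f E
    \<and> (f has_derivative (\<lambda>h. J *v h)) (at E) \<and> jacobian f (at E) = J
    \<and> charpoly (jacobian f (at E)) = [:A3, A2, A1, 1:]
    \<and> (DF > 0 \<and> A1 > 0 \<and> A3 > 0 \<and> A1 * A2 - A3 > 0
        \<longrightarrow> (\<forall>m'. 0 < m' \<and> m' \<le> 1 \<longrightarrow> locally_asymptotically_stable m' f E))
    \<and> (DF < 0 \<and> A1 \<ge> 0 \<and> A2 \<ge> 0 \<and> A3 > 0 \<and> 0 < m \<and> m < 2/3
        \<longrightarrow> locally_asymptotically_stable m f E)
    \<and> (DF < 0 \<and> A1 < 0 \<and> A2 < 0 \<and> m > 2/3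
        \<longrightarrow> unstable m f E)
    \<and> (DF < 0 \<and> A1 > 0 \<and> A2 > 0 \<and> A1 * A2 = A3 \<and> 0 < m \<and> m < 1
        \<longrightarrow> locally_asymptotically_stable m f E)"
proof -
  have nz: "xs + a > 0" "a + xs > 0" "ys + d > 0" "ys + r > 0" using pos ex by auto
  \<comment> \<open>Squaring removes the root and shows that the point lies on the prey nullcline y
    = (1 - x)(x + a).\<close>
  have "(xs - (1 - a) / 2)\<^sup>2 = ((1 + a) / 2)\<^sup>2 - ys" using ex unfolding xs by simp
  then have yx: "ys = (1 - xs) * (xs + a)"
    by (simp add: field_simps power2_eq_square)
  have qp: "q = p * (ys + r)" using pos ys by simp
  have zd: "zs / (ys + d) = c * xs / (xs + a) - b"
    using nz unfolding zs by (simp add: add.commute)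
  have E_nth: "E $ 1 = xs" "E $ 2 = ys" "E $ 3 = zs" by (simp_all add: E)
  have fE: "f E = 0"
  proof -
    have "xs * (1 - xs) - xs * ys / (xs + a) = 0" using nz by (simp add: yx)
    moreover have "c * xs * ys / (xs + a) - b * ys - ys * zs / (ys + d)
        = ys * (c * xs / (xs + a) - b - zs / (ys + d))"
      by (simp add: algebra_simps)
    moreover have "p * zs^2 - q * zs^2 / (ys + r) = 0" using nz by (simp add: qp)
    ultimately show ?thesis
      by (simp add: f food_chain_field_def E_nth vec_eq_iff forall_3 zd)
  qed
  have deriv: "(f has_derivative (\<lambda>h. J *v h)) (at E)"
  proof -
    \<comment> \<open>The prey nullcline brings the first two entries of the first column into the
      form used in \<open>J\<close>.\<close>
    have ax: "ys / (xs + a)^2 = (1 - xs) / (a + xs)"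
      using nz unfolding yx by (simp add: power2_eq_square add.commute)
    have "a * ys / (xs + a)^2 = a * ((1 - xs) / (a + xs))"
      unfolding ax[symmetric] by simp
    moreover have "1 - 2 * xs - a * ((1 - xs) / (a + xs)) = xs / (a + xs) * (1 - a - 2 * xs)"
      using nz by (simp add: field_simps)
    ultimately have "1 - 2 * xs - a * ys / (xs + a)^2 = xs / (a + xs) * (1 - a - 2 * xs)"
      by simp
    moreover have "a * c * ys / (xs + a)^2 = a * c * (1 - xs) / (a + xs)"
      unfolding times_divide_eq_right[symmetric] ax ..
    \<comment> \<open>The nullcline of the middle species, \<open>zd\<close>, replaces the growth
      term by zs / (ys + d).\<close>
    moreover have "c * xs / (xs + a) - b - d * zs / (ys + d)^2 = ys * zs / (ys + d)^2"
    proof -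
      have "zs / (ys + d) - d * zs / (ys + d)^2 = ys * zs / (ys + d)^2"
        using nz by (simp add: divide_simps power2_eq_square) (simp add: algebra_simps)
      then show ?thesis using zd by simp
    qed
    moreover have "q * zs^2 / (ys + r)^2 = p * zs^2 / (ys + r)"
      using nz unfolding qp by (simp add: power2_eq_square)
    moreover have "2 * p * zs - 2 * q * zs / (ys + r) = 0"
      using nz unfolding qp by simp
    ultimately show ?thesis
      using food_chain_field_has_derivative[of E a d r b c p q] nz
      unfolding f J E_nth by (simp add: add.commute)
  qed
  have jac: "jacobian f (at E) = J"
    using frechet_derivative_at[OF deriv] unfolding jacobian_def
    by (metis matrix_of_matrix_vector_mul)
  have cp: "charpoly J = [:A3, A2, A1, 1:]"
  proof -
    \<comment> \<open>With the reciprocals as atoms, the comparison of coefficients is a polynomial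
      identity that needs no division.\<close>
    define I K L where "I = 1 / (a + xs)" and "K = 1 / (ys + d)" and "L = 1 / (ys + r)"
    have "u / (a + xs) = u * I" "u / (a + xs)^2 = u * I^2"
      "u / (ys + d) = u * K" "u / (ys + d)^2 = u * K^2" "u / (ys + r) = u * L"
      "u / ((ys + r) * (ys + d)) = u * L * K" "u / ((a + xs) * (ys + d)^2) = u * I * K^2" for u
      by (simp_all add: I_def K_def L_def power_divide)
    note recip = this
    show ?thesis
      unfolding charpoly_3 det_3 J A1 A2 A3 vector_3 recip
      by (simp add: algebra_simps power2_eq_square)
  qed
  have eig: "eigenvalues J = {z. poly (map_poly complex_of_real [:A3, A2, A1, 1:]) z = 0}"
    unfolding eigenvalues_def cp ..
  have nonzero: "z \<noteq> 0" if "A3 > 0" "z \<in> eigenvalues J" for z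
    using that by (auto simp: eig map_poly_pCons)
  have "locally_asymptotically_stable m' f E"
    if "A1 > 0" "A3 > 0" "A1 * A2 - A3 > 0" "m' \<le> 1" for m'
    unfolding locally_asymptotically_stable_def jac
  proof
    fix z assume z: "z \<in> eigenvalues J"
    then have "pi / 2 < \<bar>Arg z\<bar>"
      using cubic_Routh_Hurwitz[of A1 A3 A2 z] that by (intro pi_half_less_abs_Arg) (auto simp: eig)
    moreover have "m' * pi / 2 \<le> pi / 2" using that by simp
    ultimately show "z \<noteq> 0 \<and> \<bar>Arg z\<bar> > m' * pi / 2"
      using nonzero[OF that(2) z] by linarith
  qed
  moreover have "locally_asymptotically_stable m f E"
    if "A1 \<ge> 0" "A2 \<ge> 0" "A3 > 0" "m < 2 / 3"
    unfolding locally_asymptotically_stable_def jac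
  proof
    fix z assume z: "z \<in> eigenvalues J"
    then have "pi / 3 \<le> \<bar>Arg z\<bar>"
      using cubic_root_pi_third_le_abs_Arg[of A1 A2 A3 z] that by (auto simp: eig)
    \<comment> \<open>The order 2/3 is the one whose critical angle m pi / 2 equals pi / 3.\<close>
    moreover have "m * pi / 2 < pi / 3" using that by simp
    ultimately show "z \<noteq> 0 \<and> \<bar>Arg z\<bar> > m * pi / 2"
      using nonzero[OF that(3) z] by linarith
  qed
  moreover have "unstable m f E" if A: "A1 < 0" "A2 < 0" "m > 2 / 3"
  proof -
    obtain z where z: "z \<in> eigenvalues J" "z \<noteq> 0" "\<bar>Arg z\<bar> < pi / 3"
      using cubic_has_root_abs_Arg_less_pi_third[OF A(1,2), of A3] unfolding eig by blast
    have "pi / 3 < m * pi / 2" using A by simp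
    then show ?thesis unfolding unstable_def jac using z by (meson less_trans)
  qed
  moreover have "locally_asymptotically_stable m f E"
    if "A1 > 0" "A2 > 0" "A1 * A2 = A3" "m < 1"
    unfolding locally_asymptotically_stable_def jac
  proof
    fix z assume z: "z \<in> eigenvalues J"
    have nz: "z \<noteq> 0" using that z by (intro nonzero) auto
    then have "pi / 2 \<le> \<bar>Arg z\<bar>"
      using cubic_critical_root_Re_nonpos[OF that(1-3)] z by (intro pi_half_le_abs_Arg) (auto simp: eig)
    \<comment> \<open>The strict inequality m < 1 makes up for eigenvalues on the imaginary
      axis.\<close>
    moreover have "m * pi / 2 < pi / 2" using that by simp
    ultimately show "z \<noteq> 0 \<and> \<bar>Arg z\<bar> > m * pi / 2" using nz by linarith
  qed
  ultimately show ?thesis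
    using caputo_equilibrium_zero[of f E m, OF fE] deriv jac cp by simp
qed

end
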